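(* Let $\Gamma$ be the group presented by $$\langle\, a,s,t \mid [a,a^t]=1,\ [s,t]=1,\ a^s = a a^t \,\rangle .$$ Then the Dehn function $\mathrm{Area}:\mathbb{N}\to\mathbb{N}$ of $\Gamma$ satisfies $\mathrm{Area}(n)\simeq 2^n$.
   Context: Conventions: $[x,y]=x^{-1}y^{-1}xy$ and $x^{y}=y^{-1}xy$. For a finite presentation $\langle A\mid R\rangle$ and a word $w$ on $A^{\pm1}$ representing the identity, $\mathrm{Area}(w)$ is the minimal $N$ such that $w$ is freely equal to $\prod_{i=1}^N u_i^{-1}r_iu_i$ for some words $u_i$ on $A^{\pm1}$ and some $r_i\in R^{\pm1}$ (a relation $u=v$ is read as the relator $uv^{-1}$). The Dehn function $\mathrm{Area}(n)$ of $\langle A\mid R\rangle$ is the maximum of $\mathrm{Area}(w)$ over all words $w$ of length at most $n$ representing the identity. For $f,g:\mathbb{N}\to\mathbb{N}$, write $f\preceq g$ when there exists $C>0$ such that $f(n)\le C g(Cn+C)+Cn+C$ for all $n$; and $f\simeq g$ when $f\preceq g$ and $g\preceq f$. Up to $\simeq$, the Dehn function does not depend on the choice of finite presentation of the group. *)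

theory Defs
  imports Main
begin

text \<open>
  Words on \<open>A\<^sup>\<plusminus>\<^sup>1\<close>, where the alphabet \<open>A\<close> is a whole type: the letter \<open>(x, True)\<close> stands
  for \<open>x\<close> and \<open>(x, False)\<close> for its formal inverse.  Words need not be reduced.
\<close>

type_synonym 'a word = "('a \<times> bool) list"

definition letter_inv :: "'a \<times> bool \<Rightarrow> 'a \<times> bool" where
  "letter_inv x = (fst x, \<not> snd x)"

definition word_inv :: "'a word \<Rightarrow> 'a word" where
  "word_inv w = rev (map letter_inv w)"

definition word_conj :: "'a word \<Rightarrow> 'a word \<Rightarrow> 'a word" where
  "word_conj x y = word_inv y @ x @ y"

definition word_comm :: "'a word \<Rightarrow> 'a word \<Rightarrow> 'a word" where
  "word_comm x y = word_inv x @ word_inv y @ x @ y"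

definition relator :: "'a word \<Rightarrow> 'a word \<Rightarrow> 'a word" where
  "relator u v = u @ word_inv v"

definition gen_word :: "'a \<Rightarrow> 'a word" where
  "gen_word x = [(x, True)]"

text \<open>
  Two words represent the same element of the group \<open>\<langle>A | R\<rangle>\<close>.  Closure under concatenation
  need not be postulated, since both kinds of elementary moves are allowed inside a word.
\<close>

inductive same_element :: "'a word set \<Rightarrow> 'a word \<Rightarrow> 'a word \<Rightarrow> bool" for R where
  refl: "same_element R w w"
| sym: "same_element R u v \<Longrightarrow> same_element R v u"
| trans: "same_element R u v \<Longrightarrow> same_element R v w \<Longrightarrow> same_element R u w"
| cancel: "same_element R (u @ [x, letter_inv x] @ v) (u @ v)"
| relator: "r \<in> R \<Longrightarrow> same_element R (u @ r @ v) (u @ v)"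

abbreviation represents_identity :: "'a word set \<Rightarrow> 'a word \<Rightarrow> bool" where
  "represents_identity R w \<equiv> same_element R w []"

abbreviation freely_equal :: "'a word \<Rightarrow> 'a word \<Rightarrow> bool" where
  "freely_equal \<equiv> same_element {}"

text \<open>
  The list \<open>ps\<close> contains the pairs \<open>(u\<^sub>i, r\<^sub>i)\<close> of the product of conjugates
  \<open>u\<^sub>i\<^sup>-\<^sup>1 r\<^sub>i u\<^sub>i\<close>.
\<close>

definition conj_product :: "('a word \<times> 'a word) list \<Rightarrow> 'a word" where
  "conj_product ps = concat (map (\<lambda>(u, r). word_conj r u) ps)"

definition is_product_of_conjugates :: "'a word set \<Rightarrow> 'a word \<Rightarrow> nat \<Rightarrow> bool" where
  "is_product_of_conjugates R w N \<longleftrightarrow>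
     (\<exists>ps. length ps = N \<and> (\<forall>(u, r) \<in> set ps. r \<in> R \<union> word_inv ` R) \<and>
           freely_equal w (conj_product ps))"

definition word_area :: "'a word set \<Rightarrow> 'a word \<Rightarrow> nat" where
  "word_area R w = (LEAST N. is_product_of_conjugates R w N)"

definition dehn_function :: "'a::finite word set \<Rightarrow> nat \<Rightarrow> nat" where
  "dehn_function R n = Max (word_area R ` {w. length w \<le> n \<and> represents_identity R w})"

definition growth_le :: "(nat \<Rightarrow> nat) \<Rightarrow> (nat \<Rightarrow> nat) \<Rightarrow> bool" (infix "\<preceq>" 50) where
  "f \<preceq> g \<longleftrightarrow> (\<exists>C>0. \<forall>n. f n \<le> C * g (C * n + C) + C * n + C)"

definition growth_equiv :: "(nat \<Rightarrow> nat) \<Rightarrow> (nat \<Rightarrow> nat) \<Rightarrow> bool" (infix "\<simeq>" 50) where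
  "f \<simeq> g \<longleftrightarrow> f \<preceq> g \<and> g \<preceq> f"

datatype gen = gen_a | gen_s | gen_t

instance gen :: finite
proof
  have "(UNIV :: gen set) = {gen_a, gen_s, gen_t}"
    using gen.exhaust by auto
  then show "finite (UNIV :: gen set)"
    by (metis finite.emptyI finite.insertI)
qed

definition \<Gamma>_relators :: "gen word set" where
  "\<Gamma>_relators =
     (let a = gen_word gen_a; s = gen_word gen_s; t = gen_word gen_t in
      {relator (word_comm a (word_conj a t)) [],
       relator (word_comm s t) [],
       relator (word_conj a s) (a @ word_conj a t)})"

text \<open>
  The facts below show that the maximum in \<open>dehn_function\<close> is over a finite nonempty set, and
  that the minimum in \<open>word_area\<close> is attained on all words representing the identity.
\<close>

lemma letter_inv_letter_inv [simp]: "letter_inv (letter_inv x) = x"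
  by (simp add: letter_inv_def)

lemma word_inv_simps [simp]:
  "word_inv [] = []"
  "word_inv (x # u) = word_inv u @ [letter_inv x]"
  "word_inv (u @ v) = word_inv v @ word_inv u"
  "word_inv (word_inv u) = u"
  by (auto simp: word_inv_def rev_map o_def)

lemma same_element_context:
  "same_element R u v \<Longrightarrow> same_element R (p @ u @ q) (p @ v @ q)"
proof (induction rule: same_element.induct)
  case (cancel u x v)
  then show ?case using same_element.cancel[of R "p @ u" x "v @ q"] by simp
next
  case (relator r u v)
  then show ?case using same_element.relator[of r R "p @ u" "v @ q"] by simp
qed (blast intro: same_element.intros)+

lemma same_element_append:
  assumes "same_element R u u'" and "same_element R v v'"
  shows "same_element R (u @ v) (u' @ v')"
  using same_element_context[OF assms(1), of "[]" v]
    same_element_context[OF assms(2), of u' "[]"]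
  by (auto intro: same_element.trans)

lemma same_element_right_inv: "same_element R (u @ word_inv u) []"
proof (induction u)
  case (Cons x u)
  have "same_element R (x # u @ word_inv u @ [letter_inv x]) [x, letter_inv x]"
    using same_element_context[OF Cons, of "[x]" "[letter_inv x]"] by simp
  moreover have "same_element R [x, letter_inv x] []"
    using same_element.cancel[of R "[]" x "[]"] by simp
  ultimately show ?case by (auto intro: same_element.trans)
qed (simp add: same_element.refl)

lemma same_element_left_inv: "same_element R (word_inv u @ u) []"
  using same_element_right_inv[of R "word_inv u"] by simp

lemma freely_equal_imp_same_element: "freely_equal u v \<Longrightarrow> same_element R u v"
proof (induction rule: same_element.induct)
  case (cancel u x v)
  show ?case by (rule same_element.cancel)
qed (auto intro: same_element.refl same_element.sym same_element.trans)

lemma conj_product_simps [simp]: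
  "conj_product [] = []"
  "conj_product (p # ps) = word_conj (snd p) (fst p) @ conj_product ps"
  "conj_product (ps @ qs) = conj_product ps @ conj_product qs"
  by (auto simp: conj_product_def split: prod.splits)

lemma word_inv_conj_product:
  "word_inv (conj_product ps) = conj_product (rev (map (\<lambda>(u, r). (u, word_inv r)) ps))"
  by (induction ps) (auto simp: word_conj_def split: prod.splits)

lemma same_element_imp_conj_product:
  assumes "same_element R u v"
  shows "\<exists>ps. (\<forall>(x, r) \<in> set ps. r \<in> R \<union> word_inv ` R) \<and> freely_equal u (conj_product ps @ v)"
  using assms
proof (induction rule: same_element.induct)
  case (refl w)
  show ?case by (rule exI[of _ "[]"]) (auto intro: same_element.refl)
next
  case (sym u v)
  then obtain ps where ps: "\<forall>(x, r) \<in> set ps. r \<in> R \<union> word_inv ` R"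
    and eq: "freely_equal u (conj_product ps @ v)" by blast
  let ?qs = "rev (map (\<lambda>(u, r). (u, word_inv r)) ps)"
  have "freely_equal (word_inv (conj_product ps) @ u)
      (word_inv (conj_product ps) @ conj_product ps @ v)"
    using same_element_context[OF eq, of _ "[]"] by simp
  moreover have "freely_equal (word_inv (conj_product ps) @ conj_product ps @ v) v"
    using same_element_context[OF same_element_left_inv, of "{}" "[]" "conj_product ps" v] by simp
  ultimately have "freely_equal v (conj_product ?qs @ u)"
    by (metis word_inv_conj_product same_element.sym same_element.trans)
  moreover have "\<forall>(x, r) \<in> set ?qs. r \<in> R \<union> word_inv ` R"
    using ps by (fastforce simp: image_iff)
  ultimately show ?case by blast
next
  case (trans u v w)
  then obtain ps qs where ps: "\<forall>(x, r) \<in> set ps. r \<in> R \<union> word_inv ` R"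
    and qs: "\<forall>(x, r) \<in> set qs. r \<in> R \<union> word_inv ` R"
    and eq: "freely_equal u (conj_product ps @ v)" "freely_equal v (conj_product qs @ w)" by blast
  have "freely_equal u (conj_product (ps @ qs) @ w)"
    using eq(1) same_element_context[OF eq(2), of "conj_product ps" "[]"]
    by (auto intro: same_element.trans)
  moreover have "\<forall>(x, r) \<in> set (ps @ qs). r \<in> R \<union> word_inv ` R"
    using ps qs by auto
  ultimately show ?case by blast
next
  case (cancel u x v)
  show ?case
    using same_element.cancel[of "{}" u x v] by (intro exI[of _ "[]"]) auto
next
  case (relator r u v)
  have "freely_equal (u @ r @ v) (u @ r @ word_inv u @ u @ v)"
    using same_element_context[OF same_element_left_inv, of "{}" "u @ r" u v]
    by (auto intro: same_element.sym)
  then show ?case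
    using relator by (intro exI[of _ "[(word_inv u, r)]"]) (auto simp: word_conj_def)
qed

lemma same_element_word_inv_relator:
  assumes "r \<in> R"
  shows "represents_identity R (word_inv r)"
  using same_element_right_inv[of R r] same_element.relator[OF assms, of "[]" "word_inv r"]
  by (auto intro: same_element.sym same_element.trans)

lemma conj_product_represents_identity:
  "\<forall>(u, r) \<in> set ps. r \<in> R \<union> word_inv ` R \<Longrightarrow> represents_identity R (conj_product ps)"
proof (induction ps)
  case Nil
  show ?case by (simp add: same_element.refl)
next
  case (Cons p ps)
  obtain u r where p: "p = (u, r)" by force
  have "represents_identity R r"
    using Cons.prems same_element_word_inv_relator[of _ R]
      same_element.relator[of r R "[]" "[]"] by (auto simp: p)
  then have "same_element R (word_inv u @ r @ u) (word_inv u @ [] @ u)"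
    by (rule same_element_context)
  then have "represents_identity R (word_conj r u)"
    using same_element_left_inv[of R u] by (auto simp: word_conj_def intro: same_element.trans)
  then show ?case
    using same_element_append[of R _ "[]" _ "[]"] Cons by (simp add: p)
qed

lemma represents_identity_iff_product_of_conjugates:
  "represents_identity R w \<longleftrightarrow> (\<exists>N. is_product_of_conjugates R w N)"
proof
  assume "represents_identity R w"
  from same_element_imp_conj_product[OF this]
  show "\<exists>N. is_product_of_conjugates R w N"
    by (auto simp: is_product_of_conjugates_def)
next
  assume "\<exists>N. is_product_of_conjugates R w N"
  then obtain ps where "\<forall>(u, r) \<in> set ps. r \<in> R \<union> word_inv ` R"
    and eq: "freely_equal w (conj_product ps)"
    by (auto simp only: is_product_of_conjugates_def)
  then have "represents_identity R (conj_product ps)"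
    by (intro conj_product_represents_identity)
  then show "represents_identity R w"
    using freely_equal_imp_same_element[OF eq, of R] by (rule same_element.trans[rotated])
qed

lemma finite_words_representing_identity:
  "finite {w :: 'a::finite word. length w \<le> n \<and> represents_identity R w}"
  using finite_lists_length_le[of "UNIV :: ('a \<times> bool) set" n]
  by (auto intro: rev_finite_subset)

lemma empty_word_representing_identity:
  "[] \<in> {w. length w \<le> n \<and> represents_identity R w}"
  by (simp add: same_element.refl)

end

theory Submission
  imports Defs Complex_Main
begin

text \<open>
  Write \<open>a\<^sub>j\<close> for \<open>t\<^sup>-\<^sup>j a t\<^sup>j\<close>.  Conjugation by \<open>s\<close> sends \<open>a\<^sub>j\<close> to \<open>a\<^sub>j a\<^sub>j\<^sub>+\<^sub>1\<close>, so \<open>\<Gamma>\<close> is the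
  semidirect product of the module \<open>\<int>[x, 1/x, 1/(1 + x)]\<close>, generated by \<open>a\<close>, with \<open>\<int>\<^sup>2\<close>, where \<open>t\<close> and
  \<open>s\<close> multiply by \<open>x\<close> and \<open>1 + x\<close>.

  \<^bold>\<open>Upper bound.\<close>  The conjugates \<open>a\<^sub>i\<close> and \<open>a\<^sub>j\<close> commute at a cost exponential in \<open>\<bar>i - j\<bar>\<close>
  (\<open>a_conj_commute\<close>): conjugating \<open>[a\<^sub>0, a\<^sub>k] = 1\<close> by \<open>s\<close> gives \<open>[a\<^sub>0 a\<^sub>1, a\<^sub>k a\<^sub>k\<^sub>+\<^sub>1] = 1\<close>, from which
  \<open>[a\<^sub>0, a\<^sub>k\<^sub>+\<^sub>1] = 1\<close> follows by using the commutators already known four times.  Given a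
  word \<open>w\<close> of length \<open>n\<close> that represents the identity, move \<open>s\<^sup>-\<^sup>n\<close> through \<open>w\<close> from left to
  right (\<open>collect_word\<close>).  The exponent of \<open>s\<close> never becomes positive, so each letter \<open>a\<close> that is met
  becomes a product of at most exponentially many \<open>a\<^sub>j\<close>, and in the end \<open>s\<^sup>-\<^sup>n w\<close> has become
  \<open>P s\<^sup>-\<^sup>n\<close> with \<open>P\<close> a word in the \<open>a\<^sub>j\<close>.  The affine actions of \<open>\<Gamma>\<close> on the real line, one for each
  value \<open>\<xi> > 0\<close> of \<open>x\<close>, show that every \<open>a\<^sub>j\<close> has exponent sum zero in \<open>P\<close>; so \<open>P\<close> can be cancelled by
  commuting its letters, with exponentially many exchanges of exponential cost each.

  \<^bold>\<open>Lower bound.\<close>  Drop the relation \<open>[a, a\<^sup>t] = 1\<close>.  The remaining group maps to the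
  semidirect product of an integral Heisenberg group with commuting automorphisms \<open>t\<close> and \<open>s\<close> that act on
  \<open>\<int>\<^sup>2\<close> by a matrix \<open>T\<close> and by \<open>1 + T\<close>.  With \<open>T\<close> of trace \<open>-3\<close> and determinant \<open>1\<close>, the
  determinant of \<open>1 + T\<close> is \<open>-1\<close>, so conjugation preserves the absolute value of central elements.
  Hence a product of \<open>N\<close> conjugates of relators of \<open>\<Gamma>\<close> is central of size at most \<open>6 N\<close>.  But
  \<open>[a, a\<^sub>n]\<close> has length linear in \<open>n\<close> and maps to a central element whose size is proportional to
  an entry of \<open>T\<^sup>n\<close>, which grows exponentially because \<open>T\<close> has an eigenvalue outside the unit
  circle.
\<close>

section \<open>Equality of words at bounded cost\<close>

declare same_element.trans [trans]

text \<open>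
  Free equalities cost nothing and a relator costs one.  A derivation of cost \<open>k\<close> from \<open>w\<close> to the empty word bounds the area of \<open>w\<close> by \<open>k\<close>, while
  costs can be added up along chains of rewriting steps inside words.  The first two rules leave
  slack in \<open>k\<close>, which makes the relation monotone in the cost.
\<close>

inductive equal_within :: "'a word set \<Rightarrow> nat \<Rightarrow> 'a word \<Rightarrow> 'a word \<Rightarrow> bool" for R where
  free: "freely_equal u v \<Longrightarrow> equal_within R k u v"
| relator: "r \<in> R \<Longrightarrow> equal_within R (Suc k) (u @ r @ v) (u @ v)"
| sym: "equal_within R k u v \<Longrightarrow> equal_within R k v u"
| trans: "equal_within R k u v \<Longrightarrow> equal_within R l v w \<Longrightarrow> equal_within R (k + l) u w"

declare equal_within.trans [trans]

lemma equal_within_refl: "equal_within R k u u"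
  by (intro equal_within.free same_element.refl)

lemma equal_within_mono: "equal_within R k u v \<Longrightarrow> k \<le> l \<Longrightarrow> equal_within R l u v"
  using equal_within.trans[OF _ equal_within_refl, of R k u v "l - k"] by simp

lemma equal_within_context: "equal_within R k u v \<Longrightarrow> equal_within R k (p @ u @ q) (p @ v @ q)"
proof (induction rule: equal_within.induct)
  case (free u v k)
  then show ?case by (intro equal_within.free same_element_context)
next
  case (relator r k u v)
  then show ?case using equal_within.relator[of r R k "p @ u" "v @ q"] by simp
qed (blast intro: equal_within.intros)+

lemma equal_within_left: "equal_within R k u v \<Longrightarrow> equal_within R k (p @ u) (p @ v)"
  using equal_within_context[of R k u v p "[]"] by simp

lemma equal_within_right: "equal_within R k u v \<Longrightarrow> equal_within R k (u @ q) (v @ q)"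
  using equal_within_context[of R k u v "[]" q] by simp

lemma equal_within_append:
  "equal_within R k u u' \<Longrightarrow> equal_within R l v v' \<Longrightarrow> equal_within R (k + l) (u @ v) (u' @ v')"
  by (blast intro: equal_within.trans equal_within_left equal_within_right)

lemma equal_within_right_inv: "equal_within R k (p @ u @ word_inv u @ q) (p @ q)"
  using equal_within_context[OF equal_within.free[OF same_element_right_inv], of R k p u q] by simp

lemma equal_within_left_inv: "equal_within R k (p @ word_inv u @ u @ q) (p @ q)"
  using equal_within_right_inv[of R k p "word_inv u" q] by simp

lemma equal_within_imp_same_element: "equal_within R k u v \<Longrightarrow> same_element R u v"
  by (induction rule: equal_within.induct)
    (auto intro: freely_equal_imp_same_element same_element.intros)

text \<open>
  A relator \<open>r\<close> applied after a prefix \<open>u\<close> is the conjugate \<open>u r u\<^sup>-\<^sup>1\<close> in front of the word, and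
  chaining two derivations concatenates their lists of conjugates; so each priced application of
  a relator contributes one factor.
\<close>

lemma equal_within_imp_conj_product:
  assumes "equal_within R k u v"
  shows "\<exists>ps. length ps \<le> k \<and> (\<forall>(x, r) \<in> set ps. r \<in> R \<union> word_inv ` R) \<and>
    freely_equal u (conj_product ps @ v)"
  using assms
proof (induction rule: equal_within.induct)
  case (free u v k)
  then show ?case by (intro exI[of _ "[]"]) auto
next
  case (relator r k u v)
  have "freely_equal (u @ r @ v) (u @ r @ word_inv u @ u @ v)"
    using same_element_context[OF same_element_left_inv, of "{}" "u @ r" u v]
    by (auto intro: same_element.sym)
  then show ?case
    using relator by (intro exI[of _ "[(word_inv u, r)]"]) (auto simp: word_conj_def)
next
  case (sym k u v)
  then obtain ps where len: "length ps \<le> k"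
    and ps: "\<forall>(x, r) \<in> set ps. r \<in> R \<union> word_inv ` R"
    and eq: "freely_equal u (conj_product ps @ v)" by blast
  let ?qs = "rev (map (\<lambda>(u, r). (u, word_inv r)) ps)"
  have "freely_equal (word_inv (conj_product ps) @ u)
      (word_inv (conj_product ps) @ conj_product ps @ v)"
    using same_element_context[OF eq, of _ "[]"] by simp
  moreover have "freely_equal (word_inv (conj_product ps) @ conj_product ps @ v) v"
    using same_element_context[OF same_element_left_inv, of "{}" "[]" "conj_product ps" v] by simp
  ultimately have "freely_equal v (conj_product ?qs @ u)"
    by (metis word_inv_conj_product same_element.sym same_element.trans)
  moreover have "\<forall>(x, r) \<in> set ?qs. r \<in> R \<union> word_inv ` R"
    using ps by (fastforce simp: image_iff)
  moreover have "length ?qs \<le> k"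
    using len by simp
  ultimately show ?case by blast
next
  case (trans k u v l w)
  then obtain ps qs where len: "length ps \<le> k" "length qs \<le> l"
    and ps: "\<forall>(x, r) \<in> set ps. r \<in> R \<union> word_inv ` R"
    and qs: "\<forall>(x, r) \<in> set qs. r \<in> R \<union> word_inv ` R"
    and eq: "freely_equal u (conj_product ps @ v)" "freely_equal v (conj_product qs @ w)" by blast
  have "freely_equal u (conj_product (ps @ qs) @ w)"
    using eq(1) same_element_context[OF eq(2), of "conj_product ps" "[]"]
    by (auto intro: same_element.trans)
  moreover have "\<forall>(x, r) \<in> set (ps @ qs). r \<in> R \<union> word_inv ` R"
    using ps qs by auto
  moreover have "length (ps @ qs) \<le> k + l"
    using len by simp
  ultimately show ?case by blast
qed

lemma word_area_le: "equal_within R k w [] \<Longrightarrow> word_area R w \<le> k"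
proof -
  assume "equal_within R k w []"
  from equal_within_imp_conj_product[OF this]
  obtain N where "N \<le> k" "is_product_of_conjugates R w N"
    unfolding is_product_of_conjugates_def by auto
  then show "word_area R w \<le> k"
    unfolding word_area_def by (meson Least_le le_trans)
qed

lemma equal_within_cancel_left: "equal_within R k (p @ u) (p @ v) \<Longrightarrow> equal_within R k u v"
proof -
  assume "equal_within R k (p @ u) (p @ v)"
  from equal_within_left[OF this, of "word_inv p"]
  have "equal_within R k (word_inv p @ p @ u) (word_inv p @ p @ v)" by simp
  with equal_within_left_inv[of R 0 "[]" p u] equal_within_left_inv[of R 0 "[]" p v]
  have "equal_within R (0 + (k + 0)) u v"
    by (intro equal_within.trans[OF equal_within.sym equal_within.trans]) auto
  then show ?thesis by simp
qed

lemma equal_within_cancel_right: "equal_within R k (u @ q) (v @ q) \<Longrightarrow> equal_within R k u v"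
proof -
  assume "equal_within R k (u @ q) (v @ q)"
  from equal_within_right[OF this, of "word_inv q"]
  have "equal_within R k (u @ q @ word_inv q) (v @ q @ word_inv q)" by simp
  with equal_within_right_inv[of R 0 u q "[]"] equal_within_right_inv[of R 0 v q "[]"]
  have "equal_within R (0 + (k + 0)) u v"
    by (intro equal_within.trans[OF equal_within.sym equal_within.trans]) auto
  then show ?thesis by simp
qed

lemma equal_within_relator:
  assumes "relator u v \<in> R" shows "equal_within R 1 u v"
proof -
  have "equal_within R 0 u (u @ word_inv v @ v)"
    using equal_within.sym[OF equal_within_left_inv[of R 0 u v "[]"]] by simp
  moreover have "equal_within R 1 (u @ word_inv v @ v) v"
    using equal_within.relator[OF assms, of 0 "[]" v] by (simp add: relator_def)
  ultimately show ?thesis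
    using equal_within.trans by fastforce
qed

lemma equal_within_commutator:
  assumes "relator (word_comm x y) [] \<in> R" shows "equal_within R 1 (x @ y) (y @ x)"
proof -
  have "equal_within R 1 (word_comm x y) []"
    using equal_within_relator[OF assms] .
  have "equal_within R 0 (x @ y) (y @ word_inv y @ x @ y)"
    using equal_within.sym[OF equal_within_right_inv[of R 0 "[]" y "x @ y"]] by simp
  also have "equal_within R 0 \<dots> (y @ x @ word_inv x @ word_inv y @ x @ y)"
    by (rule equal_within.sym[OF equal_within_right_inv])
  also have "equal_within R 1 \<dots> (y @ x)"
    using equal_within_left[OF \<open>equal_within R 1 (word_comm x y) []\<close>, of "y @ x"]
    by (simp add: word_comm_def)
  finally show ?thesis by simp
qed

text \<open>
  This is \<open>u x u\<^sup>-\<^sup>1 = y\<close> at cost \<open>k\<close>, stated as the passage of \<open>u\<close> through \<open>x\<close>.  In this form costs add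
  up along products of the \<open>x\<close> and along products of the \<open>u\<close>, and the case \<open>x = y\<close> is commutation.
\<close>

definition intertwines :: "'a word set \<Rightarrow> nat \<Rightarrow> 'a word \<Rightarrow> 'a word \<Rightarrow> 'a word \<Rightarrow> bool" where
  "intertwines R k u x y \<longleftrightarrow> equal_within R k (u @ x) (y @ u)"

lemma intertwines_mono: "intertwines R k u x y \<Longrightarrow> k \<le> l \<Longrightarrow> intertwines R l u x y"
  unfolding intertwines_def by (rule equal_within_mono)

lemma intertwines_append:
  assumes "intertwines R k u x y" "intertwines R l u x' y'"
  shows "intertwines R (k + l) u (x @ x') (y @ y')"
  using equal_within.trans[OF equal_within_right[OF assms(1)[unfolded intertwines_def], of x']]
    equal_within_left[OF assms(2)[unfolded intertwines_def], of y]
  unfolding intertwines_def by simp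

lemma intertwines_compose:
  assumes "intertwines R k u x y" "intertwines R l v y z"
  shows "intertwines R (k + l) (v @ u) x z"
  using equal_within.trans[OF equal_within_left[OF assms(1)[unfolded intertwines_def], of v]]
    equal_within_right[OF assms(2)[unfolded intertwines_def], of u]
  unfolding intertwines_def by simp

lemma intertwines_word_inv:
  assumes "intertwines R k u x y" shows "intertwines R k u (word_inv x) (word_inv y)"
proof -
  have "equal_within R k (word_inv y @ y @ u @ word_inv x) (word_inv y @ u @ x @ word_inv x)"
    using equal_within_context[OF equal_within.sym[OF assms[unfolded intertwines_def]],
        of "word_inv y" "word_inv x"] by simp
  from equal_within.trans[OF this]
  have "equal_within R k (word_inv y @ y @ u @ word_inv x) (word_inv y @ u)"
    using equal_within_right_inv[of R 0 "word_inv y @ u" x "[]"] by fastforce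
  from equal_within.trans[OF _ this, of 0] equal_within.sym[OF equal_within_left_inv[of R 0 "[]" y "u @ word_inv x"]]
  show ?thesis
    unfolding intertwines_def by simp
qed

lemma intertwines_inv:
  assumes "intertwines R k u x y" shows "intertwines R k (word_inv u) y x"
proof -
  have "equal_within R 0 (u @ (word_inv u @ y) @ u) (y @ u)"
    using equal_within_right_inv[of R 0 "[]" u "y @ u"] by simp
  also have "equal_within R k (y @ u) (u @ x)"
    using assms unfolding intertwines_def by (rule equal_within.sym)
  also have "equal_within R 0 (u @ x) (u @ (x @ word_inv u) @ u)"
    using equal_within.sym[OF equal_within_left_inv[of R 0 "u @ x" u "[]"]] by simp
  finally have "equal_within R k (u @ (word_inv u @ y) @ u) (u @ (x @ word_inv u) @ u)"
    by simp
  then show ?thesis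
    unfolding intertwines_def by (rule equal_within_cancel_right[OF equal_within_cancel_left])
qed

text \<open>
  Each of \<open>x x'\<close> and \<open>x' x\<close> is conjugated once by \<open>u\<close>, which accounts for the factor two.
\<close>

lemma commute_transport:
  assumes x: "intertwines R k u x y" and x': "intertwines R l u x' y'"
    and comm: "equal_within R c (x @ x') (x' @ x)"
  shows "equal_within R (c + 2 * (k + l)) (y @ y') (y' @ y)"
proof -
  have "equal_within R (k + l) ((y @ y') @ u) (u @ x @ x')"
    using equal_within.sym[OF intertwines_append[OF x x', unfolded intertwines_def]] by simp
  also have "equal_within R c (u @ x @ x') (u @ x' @ x)"
    using equal_within_left[OF comm] .
  also have "equal_within R (l + k) (u @ x' @ x) ((y' @ y) @ u)"
    using intertwines_append[OF x' x] unfolding intertwines_def by simp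
  finally have "equal_within R (k + l + c + (l + k)) (y @ y') (y' @ y)"
    by (rule equal_within_cancel_right)
  then show ?thesis
    by (rule equal_within_mono) simp
qed

section \<open>Powers of generators and the conjugates of \<open>a\<close> by powers of \<open>t\<close>\<close>

definition gen_pow :: "'a \<Rightarrow> int \<Rightarrow> 'a word" where
  "gen_pow x j = replicate (nat \<bar>j\<bar>) (x, 0 \<le> j)"

lemma length_gen_pow [simp]: "length (gen_pow x j) = nat \<bar>j\<bar>"
  by (simp add: gen_pow_def)

lemma gen_pow_0 [simp]: "gen_pow x 0 = []"
  by (simp add: gen_pow_def)

lemma word_inv_gen_pow [simp]: "word_inv (gen_pow x j) = gen_pow x (- j)"
  by (cases "j = 0") (auto simp: gen_pow_def word_inv_def letter_inv_def)

lemma gen_pow_neg_Suc: "gen_pow x (- int (Suc m)) = gen_pow x (- int m) @ [(x, False)]"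
  by (cases m) (auto simp: gen_pow_def replicate_append_same nat_add_distrib)

lemma gen_pow_add_one: "freely_equal (gen_pow x (j + 1)) (gen_pow x j @ [(x, True)])"
proof (cases "0 \<le> j")
  case True
  then have "gen_pow x (j + 1) = gen_pow x j @ [(x, True)]"
    by (simp add: gen_pow_def nat_add_distrib replicate_append_same)
  then show ?thesis by (simp add: same_element.refl)
next
  case False
  then have "gen_pow x j = gen_pow x (j + 1) @ [(x, False)]"
    using gen_pow_neg_Suc[of x "nat (- j - 1)"] by (simp add: add.commute)
  then show ?thesis
    using same_element.cancel[of "{}" "gen_pow x (j + 1)" "(x, False)" "[]"]
    by (auto simp: letter_inv_def intro: same_element.sym)
qed

lemma gen_pow_add: "freely_equal (gen_pow x i @ gen_pow x j) (gen_pow x (i + j))"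
proof (induction j rule: int_induct[where k = 0])
  case base
  show ?case by (simp add: same_element.refl)
next
  case (step1 j)
  have "freely_equal (gen_pow x i @ gen_pow x (j + 1)) ((gen_pow x i @ gen_pow x j) @ [(x, True)])"
    using same_element_context[OF gen_pow_add_one, of "gen_pow x i" x j "[]"] by simp
  also have "freely_equal \<dots> (gen_pow x (i + j) @ [(x, True)])"
    using same_element_context[OF step1(2), of "[]"] by simp
  also have "freely_equal \<dots> (gen_pow x (i + (j + 1)))"
    using same_element.sym[OF gen_pow_add_one, of x "i + j"] by (simp add: algebra_simps)
  finally show ?case .
next
  case (step2 j)
  have "freely_equal ((gen_pow x i @ gen_pow x (j - 1)) @ [(x, True)]) (gen_pow x i @ gen_pow x j)"
    using same_element_context[OF same_element.sym[OF gen_pow_add_one], of "gen_pow x i" x "j - 1" "[]"]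
    by simp
  also have "freely_equal \<dots> (gen_pow x (i + j))"
    by (rule step2(2))
  also have "freely_equal \<dots> (gen_pow x (i + (j - 1)) @ [(x, True)])"
    using gen_pow_add_one[of x "i + j - 1"] by (simp add: algebra_simps)
  finally have "equal_within {} 0 ((gen_pow x i @ gen_pow x (j - 1)) @ [(x, True)])
      (gen_pow x (i + (j - 1)) @ [(x, True)])"
    by (rule equal_within.free)
  from equal_within_imp_same_element[OF equal_within_cancel_right[OF this]] show ?case .
qed

text \<open>
  A word over the alphabet \<open>\<int>\<close> encodes a product of the conjugates of \<open>a\<^sup>\<plusminus>\<^sup>1\<close> by powers of \<open>t\<close>, the
  letter \<open>(j, b)\<close> standing for \<open>a\<^sub>j\<close> or its inverse.
\<close>

definition a_conj :: "int \<times> bool \<Rightarrow> gen word" where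
  "a_conj l = word_conj [(gen_a, snd l)] (gen_pow gen_t (fst l))"

definition a_prod :: "int word \<Rightarrow> gen word" where
  "a_prod P = concat (map a_conj P)"

lemma a_prod_simps [simp]:
  "a_prod [] = []"
  "a_prod (l # P) = a_conj l @ a_prod P"
  "a_prod (P @ Q) = a_prod P @ a_prod Q"
  by (auto simp: a_prod_def)

lemma a_conj_letter_inv: "a_conj (letter_inv l) = word_inv (a_conj l)"
  by (simp add: a_conj_def word_conj_def letter_inv_def)

lemma t_pow_intertwines_a_conj:
  "intertwines R k (gen_pow gen_t i) (a_conj (j, b)) (a_conj (j - i, b))"
proof -
  have "freely_equal (gen_pow gen_t i @ a_conj (j, b))
      ((gen_pow gen_t i @ gen_pow gen_t (- j)) @ [(gen_a, b)] @ gen_pow gen_t j)"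
    by (simp add: a_conj_def word_conj_def same_element.refl)
  also have "freely_equal \<dots> (gen_pow gen_t (i - j) @ [(gen_a, b)] @ gen_pow gen_t (j - i + i))"
    using same_element_context[OF gen_pow_add, of "[]" gen_t i "- j"] by simp
  also have "freely_equal \<dots> (gen_pow gen_t (i - j) @ [(gen_a, b)] @ gen_pow gen_t (j - i) @ gen_pow gen_t i)"
    using same_element_context[OF same_element.sym[OF gen_pow_add[of gen_t "j - i" i]],
        of "gen_pow gen_t (i - j) @ [(gen_a, b)]" "[]"] by simp
  also have "\<dots> = a_conj (j - i, b) @ gen_pow gen_t i"
    by (simp add: a_conj_def word_conj_def)
  finally show ?thesis
    unfolding intertwines_def by (rule equal_within.free)
qed

section \<open>Commutators of conjugates of \<open>a\<close>\<close>

abbreviation equal_within_\<Gamma> :: "gen word \<Rightarrow> nat \<Rightarrow> gen word \<Rightarrow> bool"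
    ("_ \<approx>\<langle>_\<rangle> _" [51, 0, 51] 50) where
  "u \<approx>\<langle>k\<rangle> v \<equiv> equal_within \<Gamma>_relators k u v"

lemma a_conj_commute_one: "a_conj (0, True) @ a_conj (1, True) \<approx>\<langle>1\<rangle> a_conj (1, True) @ a_conj (0, True)"
  by (rule equal_within_commutator)
    (simp add: \<Gamma>_relators_def gen_word_def a_conj_def word_conj_def gen_pow_def Let_def letter_inv_def)

lemma s_commutes_t: "[(gen_s, True)] @ [(gen_t, True)] \<approx>\<langle>1\<rangle> [(gen_t, True)] @ [(gen_s, True)]"
  by (rule equal_within_commutator) (simp add: \<Gamma>_relators_def gen_word_def Let_def)

lemma s_inv_intertwines_a:
  "intertwines \<Gamma>_relators 1 [(gen_s, False)] [(gen_a, True)] (a_conj (0, True) @ a_conj (1, True))"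
proof -
  have "[(gen_s, False), (gen_a, True), (gen_s, True)] \<approx>\<langle>1\<rangle> a_conj (0, True) @ a_conj (1, True)"
    by (rule equal_within_relator)
      (simp add: \<Gamma>_relators_def gen_word_def a_conj_def word_conj_def gen_pow_def Let_def letter_inv_def)
  from equal_within_right[OF this, of "[(gen_s, False)]"]
  have "[(gen_s, False), (gen_a, True), (gen_s, True), (gen_s, False)]
      \<approx>\<langle>1\<rangle> (a_conj (0, True) @ a_conj (1, True)) @ [(gen_s, False)]" by simp
  with equal_within_left_inv[of \<Gamma>_relators 0 "[(gen_s, False), (gen_a, True)]" "[(gen_s, False)]" "[]"]
  have "[(gen_s, False), (gen_a, True)] \<approx>\<langle>0 + 1\<rangle> (a_conj (0, True) @ a_conj (1, True)) @ [(gen_s, False)]"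
    by (intro equal_within.trans[OF equal_within.sym]) (auto simp: letter_inv_def)
  then show ?thesis by (simp add: intertwines_def)
qed

lemma intertwines_replicate:
  assumes "intertwines R k u [x] [x]"
  shows "intertwines R (n * k) u (replicate n x) (replicate n x)"
proof (induction n)
  case 0
  show ?case by (simp add: intertwines_def equal_within_refl)
next
  case (Suc n)
  from intertwines_append[OF assms Suc] show ?case by simp
qed

lemma s_intertwines_t_pow:
  "intertwines \<Gamma>_relators (nat \<bar>q\<bar>) [(gen_s, b)] (gen_pow gen_t q) (gen_pow gen_t q)"
proof -
  have *: "intertwines \<Gamma>_relators 1 [(gen_s, True)] [(gen_t, True)] [(gen_t, True)]"
    using s_commutes_t by (simp add: intertwines_def)
  have **: "intertwines \<Gamma>_relators 1 [(gen_s, True)] [(gen_t, c)] [(gen_t, c)]" for c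
    using * intertwines_word_inv[OF *] by (cases c) (auto simp: letter_inv_def)
  have "intertwines \<Gamma>_relators 1 [(gen_s, b)] [(gen_t, c)] [(gen_t, c)]" for c
    using **[of c] intertwines_inv[OF **[of c]] by (cases b) (auto simp: letter_inv_def)
  from intertwines_replicate[OF this] show ?thesis
    by (simp add: gen_pow_def)
qed

text \<open>
  The image of a letter under multiplication by \<open>1 + x\<close>, which is how \<open>s\<close> acts: \<open>a\<^sub>j\<close> becomes
  \<open>a\<^sub>j a\<^sub>j\<^sub>+\<^sub>1\<close>, and an inverse letter the inverse of that product.
\<close>

definition double_letter :: "int \<times> bool \<Rightarrow> int word" where
  "double_letter l = (if snd l then [l, (fst l + 1, True)] else [(fst l + 1, False), l])"

text \<open>
  The relation \<open>a\<^sup>s = a a\<^sup>t\<close> is used once; the rest of the cost is for moving \<open>s\<close> through \<open>t\<^sup>-\<^sup>j\<close> and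
  \<open>t\<^sup>j\<close>.
\<close>

lemma s_inv_intertwines_a_conj_True:
  "intertwines \<Gamma>_relators (2 * nat \<bar>j\<bar> + 1) [(gen_s, False)] (a_conj (j, True))
     (a_conj (j, True) @ a_conj (j + 1, True))"
proof -
  let ?t = "gen_pow gen_t"
  let ?y = "a_conj (0, True) @ a_conj (1, True)"
  have "intertwines \<Gamma>_relators (nat \<bar>- j\<bar> + (1 + nat \<bar>j\<bar>)) [(gen_s, False)]
      (?t (- j) @ [(gen_a, True)] @ ?t j) (?t (- j) @ ?y @ ?t j)"
    by (intro intertwines_append s_intertwines_t_pow s_inv_intertwines_a)
  then have "[(gen_s, False)] @ a_conj (j, True)
      \<approx>\<langle>2 * nat \<bar>j\<bar> + 1\<rangle> (?t (- j) @ ?y @ ?t j) @ [(gen_s, False)]"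
    by (simp add: intertwines_def a_conj_def word_conj_def mult_2)
  also have "(?t (- j) @ ?y) @ ?t j @ [(gen_s, False)]
      \<approx>\<langle>0\<rangle> ((a_conj (j, True) @ a_conj (j + 1, True)) @ ?t (- j)) @ ?t j @ [(gen_s, False)]"
    using intertwines_append[OF t_pow_intertwines_a_conj[of \<Gamma>_relators 0 "- j" 0 True]
        t_pow_intertwines_a_conj[of \<Gamma>_relators 0 "- j" 1 True]]
    by (intro equal_within_right) (simp add: intertwines_def add.commute)
  then have "(?t (- j) @ ?y @ ?t j) @ [(gen_s, False)]
      \<approx>\<langle>0\<rangle> (a_conj (j, True) @ a_conj (j + 1, True)) @ ?t (- j) @ ?t j @ [(gen_s, False)]"
    by simp
  also have "\<dots> \<approx>\<langle>0\<rangle> (a_conj (j, True) @ a_conj (j + 1, True)) @ [(gen_s, False)]"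
    using equal_within_left_inv[of \<Gamma>_relators 0 "a_conj (j, True) @ a_conj (j + 1, True)" "?t j"]
    by simp
  finally show ?thesis by (simp add: intertwines_def)
qed

lemma s_inv_intertwines_a_conj:
  "intertwines \<Gamma>_relators (2 * nat \<bar>fst l\<bar> + 1) [(gen_s, False)] (a_conj l) (a_prod (double_letter l))"
proof (cases l)
  case (Pair j b)
  have *: "intertwines \<Gamma>_relators (2 * nat \<bar>j\<bar> + 1) [(gen_s, False)] (a_conj (letter_inv (j, True)))
     (a_conj (letter_inv (j + 1, True)) @ a_conj (letter_inv (j, True)))"
    using intertwines_word_inv[OF s_inv_intertwines_a_conj_True[of j]]
    by (simp only: a_conj_letter_inv word_inv_simps)
  show ?thesis
    using * s_inv_intertwines_a_conj_True[of j]
    by (cases b) (auto simp: Pair letter_inv_def double_letter_def)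
qed

lemma a_conj_commute_shift:
  assumes "a_conj (0, True) @ a_conj (d, True) \<approx>\<langle>c\<rangle> a_conj (d, True) @ a_conj (0, True)"
  shows "a_conj (i, True) @ a_conj (i + d, True) \<approx>\<langle>c\<rangle> a_conj (i + d, True) @ a_conj (i, True)"
  using commute_transport[OF t_pow_intertwines_a_conj[of _ 0 "- i" 0]
      t_pow_intertwines_a_conj[of _ 0 "- i" d] assms]
  by (simp add: add.commute)

text \<open>
  In the step from \<open>k\<close> to \<open>k + 1\<close>, the commutation of \<open>a\<^sub>0 a\<^sub>1\<close> with \<open>a\<^sub>k a\<^sub>k\<^sub>+\<^sub>1\<close> is the image of
  \<open>[a\<^sub>0, a\<^sub>k] = 1\<close> under conjugation by \<open>s\<close>.  All pairs other than \<open>a\<^sub>0, a\<^sub>k\<^sub>+\<^sub>1\<close> that have to be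
  exchanged there are at distance at most \<open>k\<close>.  So the cost is multiplied by four, up to a term
  linear in \<open>k\<close>, and \<open>16\<^sup>k\<close> is a convenient bound.
\<close>

lemma a_conj_commute_True:
  "\<bar>i - j\<bar> \<le> int k \<Longrightarrow>
    a_conj (i, True) @ a_conj (j, True) \<approx>\<langle>16 ^ k\<rangle> a_conj (j, True) @ a_conj (i, True)"
proof (induction k arbitrary: i j)
  case 0
  then show ?case by (simp add: equal_within_refl)
next
  case (Suc k)
  let ?A = "\<lambda>i. a_conj (i, True)"
  let ?k = "int k"
  (* Shifting the indices by conjugation with a power of t is free, so one pair at distance
     k + 1 is enough. *)
  have key: "?A 0 @ ?A (?k + 1) \<approx>\<langle>16 ^ Suc k\<rangle> ?A (?k + 1) @ ?A 0"
  proof (cases "k = 0")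
    case True
    then show ?thesis using equal_within_mono[OF a_conj_commute_one] by simp
  next
    case False
    (* For k = 0 the indices 1 and k are at distance k + 1, so the exchange of their letters in the
       second step is covered by the induction hypothesis only for positive k. *)
    have "?A ?k @ (?A 0 @ ?A (?k + 1)) @ ?A 1 \<approx>\<langle>16 ^ k + 16 ^ k\<rangle> ?A 0 @ ?A ?k @ ?A 1 @ ?A (?k + 1)"
      using equal_within_append[OF Suc.IH[of ?k 0] Suc.IH[of "?k + 1" 1]] by simp
    also have "\<dots> \<approx>\<langle>16 ^ k\<rangle> (?A 0 @ ?A 1) @ ?A ?k @ ?A (?k + 1)"
      using equal_within_context[OF Suc.IH[of ?k 1], of "?A 0" "?A (?k + 1)"] False by simp
    also have "\<dots> \<approx>\<langle>16 ^ k + 2 * (1 + (2 * k + 1))\<rangle> (?A ?k @ ?A (?k + 1)) @ ?A 0 @ ?A 1"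
      using commute_transport[OF s_inv_intertwines_a_conj_True[of 0]
          s_inv_intertwines_a_conj_True[of ?k] Suc.IH[of 0 ?k]] by simp
    finally have "?A ?k @ (?A 0 @ ?A (?k + 1)) @ ?A 1
        \<approx>\<langle>16 ^ k + 16 ^ k + 16 ^ k + (16 ^ k + 2 * (1 + (2 * k + 1)))\<rangle>
        ?A ?k @ (?A (?k + 1) @ ?A 0) @ ?A 1"
      by simp
    from equal_within_cancel_right[OF equal_within_cancel_left[OF this]]
    show ?thesis
    proof (rule equal_within_mono)
      have "k < 16 ^ k" by (rule order.strict_trans1[OF _ power_gt_expt]) auto
      then show "16 ^ k + 16 ^ k + 16 ^ k + (16 ^ k + 2 * (1 + (2 * k + 1))) \<le> (16::nat) ^ Suc k"
        by simp
    qed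
  qed
  consider "\<bar>i - j\<bar> \<le> ?k" | "j = i + (?k + 1)" | "i = j + (?k + 1)"
    using Suc.prems by linarith
  then show ?case
  proof cases
    case 1
    from equal_within_mono[OF Suc.IH[OF this]] show ?thesis by simp
  next
    case 2
    then show ?thesis using a_conj_commute_shift[OF key, of i] by simp
  next
    case 3
    then show ?thesis using equal_within.sym[OF a_conj_commute_shift[OF key, of j]] by simp
  qed
qed

lemma a_conj_commute:
  assumes "\<bar>fst l - fst m\<bar> \<le> int k"
  shows "intertwines \<Gamma>_relators (16 ^ k) (a_conj l) (a_conj m) (a_conj m)"
proof -
  obtain i b j c where [simp]: "l = (i, b)" "m = (j, c)" by (cases l; cases m)
  have *: "intertwines \<Gamma>_relators (16 ^ k) (a_conj (i, True)) (a_conj (j, True)) (a_conj (j, True))"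
    using a_conj_commute_True assms by (simp add: intertwines_def)
  have **: "intertwines \<Gamma>_relators (16 ^ k) (a_conj (i, True)) (a_conj (j, c)) (a_conj (j, c))"
    using * intertwines_word_inv[OF *]
    by (cases c) (auto simp: a_conj_letter_inv[symmetric] letter_inv_def)
  show ?thesis
    using ** intertwines_inv[OF **]
    by (cases b) (auto simp: a_conj_letter_inv[symmetric] letter_inv_def)
qed

lemma intertwines_a_prod:
  assumes "\<And>m. m \<in> set P \<Longrightarrow> intertwines R c u (a_conj m) (a_conj m)"
  shows "intertwines R (length P * c) u (a_prod P) (a_prod P)"
  using assms
proof (induction P)
  case Nil
  show ?case by (simp add: intertwines_def equal_within_refl)
next
  case (Cons l P)
  then show ?case
    using intertwines_append[of R c u "a_conj l" "a_conj l" "length P * c" "a_prod P" "a_prod P"]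
    by simp
qed

definition exponent_sum :: "int word \<Rightarrow> int \<Rightarrow> int" where
  "exponent_sum P j = (\<Sum>l\<leftarrow>P. if fst l = j then (if snd l then 1 else - 1) else 0)"

lemma exponent_sum_simps [simp]:
  "exponent_sum [] j = 0"
  "exponent_sum (l # P) j = (if fst l = j then (if snd l then 1 else - 1) else 0) + exponent_sum P j"
  "exponent_sum (P @ Q) j = exponent_sum P j + exponent_sum Q j"
  by (auto simp: exponent_sum_def)

lemma exponent_sum_sign:
  assumes "(j, \<not> b) \<notin> set P" shows "0 \<le> (if b then 1 else - 1) * exponent_sum P j"
  using assms by (induction P) (auto split: if_splits)

text \<open>
  The first letter of \<open>P\<close> has its inverse further on in \<open>P\<close>, since its exponent sum vanishes.  Moving
  it there takes fewer than \<open>length P\<close> exchanges and shortens \<open>P\<close> by two letters.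
\<close>

lemma a_prod_exponent_sum_zero:
  assumes "\<And>l m. l \<in> set P \<Longrightarrow> m \<in> set P \<Longrightarrow> intertwines \<Gamma>_relators c (a_conj l) (a_conj m) (a_conj m)"
    and "\<And>j. exponent_sum P j = 0"
  shows "a_prod P \<approx>\<langle>c * (length P)\<^sup>2\<rangle> []"
  using assms
proof (induction P rule: length_induct)
  case (1 P)
  show ?case
  proof (cases P)
    case Nil
    then show ?thesis by (simp add: equal_within_refl)
  next
    case (Cons l P')
    have "letter_inv l \<in> set P'"
    proof (rule ccontr)
      assume "letter_inv l \<notin> set P'"
      then have "0 \<le> (if snd l then 1 else - 1) * exponent_sum P' (fst l)"
        by (intro exponent_sum_sign) (auto simp: letter_inv_def)
      moreover have "exponent_sum P (fst l) = 0"
        by (rule 1(3))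
      ultimately show False
        by (auto simp: Cons split: if_splits)
    qed
    then obtain Q S where P': "P' = Q @ letter_inv l # S"
      by (meson split_list)
    have "intertwines \<Gamma>_relators (length Q * c) (a_conj l) (a_prod Q) (a_prod Q)"
      using 1(2) by (intro intertwines_a_prod) (auto simp: Cons P')
    from equal_within_right[OF this[unfolded intertwines_def], of "word_inv (a_conj l) @ a_prod S"]
    have "a_prod P \<approx>\<langle>length Q * c\<rangle> a_prod Q @ a_conj l @ word_inv (a_conj l) @ a_prod S"
      by (simp add: Cons P' a_conj_letter_inv)
    also have "\<dots> \<approx>\<langle>0\<rangle> a_prod (Q @ S)"
      using equal_within_right_inv[of _ 0 "a_prod Q" "a_conj l" "a_prod S"] by simp
    also have "a_prod (Q @ S) \<approx>\<langle>c * (length (Q @ S))\<^sup>2\<rangle> []"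
    proof -
      have "exponent_sum (Q @ S) j = 0" for j
        using 1(3)[of j] by (auto simp: Cons P' letter_inv_def split: if_splits)
      then show ?thesis
        using 1(1)[rule_format, of "Q @ S"] 1(2) by (auto simp: Cons P')
    qed
    finally show ?thesis
    proof (rule equal_within_mono)
      have "length Q + (length (Q @ S))\<^sup>2 \<le> (length P)\<^sup>2"
        by (simp add: Cons P' power2_eq_square algebra_simps)
      then have "c * (length Q + (length (Q @ S))\<^sup>2) \<le> c * (length P)\<^sup>2"
        by (rule mult_le_mono2)
      then show "length Q * c + 0 + c * (length (Q @ S))\<^sup>2 \<le> c * (length P)\<^sup>2"
        by (simp only: algebra_simps)
    qed
  qed
qed

section \<open>Collecting the letters \<open>a\<close> of a word\<close>

definition double :: "int word \<Rightarrow> int word" where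
  "double P = concat (map double_letter P)"

lemma double_simps [simp]:
  "double [] = []" "double (l # P) = double_letter l @ double P"
  by (auto simp: double_def)

lemma length_double [simp]: "length (double P) = 2 * length P"
  by (induction P) (auto simp: double_letter_def)

lemma double_bound:
  "\<forall>l \<in> set P. \<bar>fst l\<bar> \<le> J \<Longrightarrow> \<forall>l \<in> set (double P). \<bar>fst l\<bar> \<le> J + 1"
  by (induction P) (auto simp: double_letter_def)

lemma s_inv_intertwines_a_prod:
  assumes "\<forall>l \<in> set P. \<bar>fst l\<bar> \<le> int J"
  shows "intertwines \<Gamma>_relators (length P * (2 * J + 1)) [(gen_s, False)] (a_prod P) (a_prod (double P))"
  using assms
proof (induction P)
  case Nil
  show ?case by (simp add: intertwines_def equal_within_refl)
next
  case (Cons l P)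
  have "intertwines \<Gamma>_relators (2 * J + 1) [(gen_s, False)] (a_conj l) (a_prod (double_letter l))"
    using Cons.prems by (intro intertwines_mono[OF s_inv_intertwines_a_conj]) auto
  from intertwines_append[OF this Cons.IH] Cons.prems show ?case by (simp add: algebra_simps)
qed

text \<open>
  Each \<open>s\<^sup>-\<^sup>1\<close> that passes doubles the length and widens the range of the indices by one.  The
  bound \<open>J\<close> on the final range controls the price per letter in all rounds.
\<close>

lemma s_pow_intertwines_a_prod:
  assumes "\<forall>l \<in> set P. \<bar>fst l\<bar> + int m \<le> int J"
  shows "\<exists>P'. intertwines \<Gamma>_relators (length P * 4 ^ m * (2 * J + 1)) (gen_pow gen_s (- int m))
      (a_prod P) (a_prod P') \<and> length P' = 2 ^ m * length P \<and> (\<forall>l \<in> set P'. \<bar>fst l\<bar> \<le> int J)"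
  using assms
proof (induction m arbitrary: P)
  case 0
  then show ?case
    by (intro exI[of _ P]) (auto simp: intertwines_def equal_within_refl)
next
  case (Suc m)
  have P: "intertwines \<Gamma>_relators (length P * (2 * J + 1)) [(gen_s, False)] (a_prod P) (a_prod (double P))"
    using Suc.prems by (intro s_inv_intertwines_a_prod) auto
  have "\<forall>l \<in> set P. \<bar>fst l\<bar> \<le> int J - int (Suc m)"
    using Suc.prems by auto
  from double_bound[OF this] have "\<forall>l \<in> set (double P). \<bar>fst l\<bar> + int m \<le> int J"
    by auto
  from Suc.IH[OF this] obtain P' where
    P': "intertwines \<Gamma>_relators (length (double P) * 4 ^ m * (2 * J + 1)) (gen_pow gen_s (- int m))
      (a_prod (double P)) (a_prod P')" "length P' = 2 ^ m * length (double P)"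
      "\<forall>l \<in> set P'. \<bar>fst l\<bar> \<le> int J" by blast
  have "1 + 2 * 4 ^ m \<le> (4::nat) ^ Suc m"
    using one_le_power[of "4::nat" m] by simp
  then have "(length P * (2 * J + 1)) * (1 + 2 * 4 ^ m) \<le> (length P * (2 * J + 1)) * 4 ^ Suc m"
    by (rule mult_le_mono2)
  then have "length P * (2 * J + 1) + length (double P) * 4 ^ m * (2 * J + 1)
      \<le> length P * 4 ^ Suc m * (2 * J + 1)"
    by (simp add: algebra_simps)
  from intertwines_mono[OF intertwines_compose[OF P P'(1)] this]
  show ?case
    using P' unfolding gen_pow_neg_Suc by (intro exI[of _ P']) auto
qed

lemma collect_step:
  assumes "u @ [x] \<approx>\<langle>c\<rangle> a_prod P @ v"
    and "v @ w \<approx>\<langle>d\<rangle> a_prod Q @ v'"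
  shows "u @ x # w \<approx>\<langle>c + d\<rangle> a_prod (P @ Q) @ v'"
  using equal_within.trans[OF equal_within_right[OF assms(1), of w]]
    equal_within_left[OF assms(2), of "a_prod P"] by simp

text \<open>
  The prefix \<open>s\<^sup>-\<^sup>m t\<^sup>q\<close> moves through \<open>w\<close>: letters \<open>s\<close> and \<open>t\<close> are absorbed into it, a letter \<open>a\<close> is
  conjugated by it and left behind.  The hypothesis \<open>length w \<le> m\<close> keeps the exponent of \<open>s\<close> from
  becoming positive; the conjugate of \<open>a\<close> is then \<open>x\<^sup>-\<^sup>q (1 + x)\<^sup>m\<close> in the module, a Laurent
  polynomial and so a product of letters \<open>a\<^sub>j\<close>.
\<close>

lemma collect_word:
  assumes "length w \<le> m" "m + length w \<le> M" "\<bar>q\<bar> + int (length w) \<le> int N"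
  shows "\<exists>P m' q'. gen_pow gen_s (- int m) @ gen_pow gen_t q @ w
      \<approx>\<langle>length w * (N + 4 ^ M * (2 * (N + M) + 1))\<rangle> a_prod P @ gen_pow gen_s (- int m') @ gen_pow gen_t q'
    \<and> length P \<le> length w * 2 ^ M \<and> (\<forall>l \<in> set P. \<bar>fst l\<bar> \<le> int (N + M))"
  using assms
proof (induction w arbitrary: m q)
  case Nil
  show ?case
    by (rule exI[of _ "[]"], rule exI[of _ m], rule exI[of _ q]) (simp add: equal_within_refl)
next
  case (Cons x w)
  let ?s = "gen_pow gen_s" and ?t = "gen_pow gen_t"
  let ?c = "N + 4 ^ M * (2 * (N + M) + 1)"
  have "\<exists>Q m1 q1. (?s (- int m) @ ?t q) @ [x] \<approx>\<langle>?c\<rangle> a_prod Q @ ?s (- int m1) @ ?t q1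
      \<and> length Q \<le> 2 ^ M \<and> (\<forall>l \<in> set Q. \<bar>fst l\<bar> \<le> int (N + M))
      \<and> length w \<le> m1 \<and> m1 + length w \<le> M \<and> \<bar>q1\<bar> + int (length w) \<le> int N"
  proof (cases x)
    case (Pair y b)
    show ?thesis
    proof (cases y)
      case gen_a
      have "\<forall>l \<in> set [(- q, b)]. \<bar>fst l\<bar> + int m \<le> int (N + M)"
        using Cons.prems by auto
      from s_pow_intertwines_a_prod[OF this] obtain Q where
        Q: "intertwines \<Gamma>_relators (4 ^ m * (2 * (N + M) + 1)) (?s (- int m)) (a_conj (- q, b)) (a_prod Q)"
        "length Q = 2 ^ m" "\<forall>l \<in> set Q. \<bar>fst l\<bar> \<le> int (N + M)" by auto
      have "intertwines \<Gamma>_relators (0 + 4 ^ m * (2 * (N + M) + 1)) (?s (- int m) @ ?t q) (a_conj (0, b)) (a_prod Q)"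
        using Q(1) t_pow_intertwines_a_conj[of \<Gamma>_relators 0 q 0 b] by (intro intertwines_compose) auto
      moreover have "(4::nat) ^ m * (2 * (N + M) + 1) \<le> 4 ^ M * (2 * (N + M) + 1)"
        using Cons.prems by (intro mult_le_mono1 power_increasing) auto
      ultimately have "intertwines \<Gamma>_relators ?c (?s (- int m) @ ?t q) (a_conj (0, b)) (a_prod Q)"
        by (elim intertwines_mono) simp
      then have "(?s (- int m) @ ?t q) @ [x] \<approx>\<langle>?c\<rangle> a_prod Q @ ?s (- int m) @ ?t q"
        by (simp add: intertwines_def a_conj_def word_conj_def Pair gen_a)
      then show ?thesis
        using Q Cons.prems by (intro exI[of _ Q] exI[of _ m] exI[of _ q]) (auto intro!: power_increasing)
    next
      case gen_s
      define e where "e = (if b then 1 else - 1 :: int)"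
      have x: "[x] = ?s e"
        by (simp add: Pair gen_s e_def gen_pow_def)
      have "intertwines \<Gamma>_relators (nat \<bar>q\<bar>) [x] (?t q) (?t q)"
        unfolding Pair gen_s by (rule s_intertwines_t_pow)
      then have "?t q @ [x] \<approx>\<langle>nat \<bar>q\<bar>\<rangle> [x] @ ?t q"
        unfolding intertwines_def by (rule equal_within.sym)
      from equal_within_left[OF this, of "?s (- int m)"]
      have "(?s (- int m) @ ?t q) @ [x] \<approx>\<langle>nat \<bar>q\<bar>\<rangle> (?s (- int m) @ ?s e) @ ?t q"
        by (simp add: x)
      also have "(?s (- int m) @ ?s e) @ ?t q \<approx>\<langle>0\<rangle> ?s (- int m + e) @ ?t q"
        by (intro equal_within_right equal_within.free gen_pow_add)
      finally have "(?s (- int m) @ ?t q) @ [x] \<approx>\<langle>?c\<rangle> ?s (- int m + e) @ ?t q"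
        by (rule equal_within_mono) (use Cons.prems in auto)
      moreover have "- int m + e = - int (nat (int m - e))"
        using Cons.prems by (auto simp: e_def)
      ultimately show ?thesis
        using Cons.prems
        by (intro exI[of _ "[]"] exI[of _ "nat (int m - e)"] exI[of _ q])
          (auto simp: e_def nat_add_distrib)
    next
      case gen_t
      define e where "e = (if b then 1 else - 1 :: int)"
      have x: "[x] = ?t e"
        by (simp add: Pair gen_t e_def gen_pow_def)
      have "?s (- int m) @ ?t q @ ?t e \<approx>\<langle>?c\<rangle> ?s (- int m) @ ?t (q + e)"
        by (intro equal_within_left equal_within.free gen_pow_add)
      then show ?thesis
        using Cons.prems
        by (intro exI[of _ "[]"] exI[of _ m] exI[of _ "q + e"]) (auto simp: e_def x)
    qed
  qed
  then obtain Q m1 q1 where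
    Q: "(?s (- int m) @ ?t q) @ [x] \<approx>\<langle>?c\<rangle> a_prod Q @ ?s (- int m1) @ ?t q1"
      "length Q \<le> 2 ^ M" "\<forall>l \<in> set Q. \<bar>fst l\<bar> \<le> int (N + M)"
    and rest: "length w \<le> m1" "m1 + length w \<le> M" "\<bar>q1\<bar> + int (length w) \<le> int N" by blast
  from Cons.IH[OF rest] obtain P m' q' where
    P: "?s (- int m1) @ ?t q1 @ w \<approx>\<langle>length w * ?c\<rangle> a_prod P @ ?s (- int m') @ ?t q'"
      "length P \<le> length w * 2 ^ M" "\<forall>l \<in> set P. \<bar>fst l\<bar> \<le> int (N + M)" by blast
  have "(?s (- int m) @ ?t q) @ x # w \<approx>\<langle>?c + length w * ?c\<rangle> a_prod (Q @ P) @ ?s (- int m') @ ?t q'"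
    using Q(1) P(1) by (intro collect_step[of _ _ _ _ "?s (- int m1) @ ?t q1"]) auto
  then show ?case
    using Q P by (intro exI[of _ "Q @ P"] exI[of _ m'] exI[of _ q']) auto
qed

section \<open>Affine actions on the real line\<close>

lemma same_element_imp_fold_eq:
  assumes "same_element R u v"
    and "\<And>x z. f (letter_inv x) (f x z) = z"
    and "\<And>r z. r \<in> R \<Longrightarrow> fold f r z = z"
  shows "fold f u z = fold f v z"
  using assms(1) by (induction arbitrary: z rule: same_element.induct) (auto simp: assms(2,3))

text \<open>
  Words act from the left end, so that \<open>u @ v\<close> acts by \<open>u\<close> first.  The translation
  by which a conjugate of \<open>a\<close> acts is its value in \<open>\<int>[x, 1/x, 1/(1 + x)]\<close> at \<open>x = \<xi>\<close>.
\<close>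

fun affine_act :: "real \<Rightarrow> gen \<times> bool \<Rightarrow> real \<Rightarrow> real" where
  "affine_act \<xi> (gen_a, b) z = (if b then z + 1 else z - 1)"
| "affine_act \<xi> (gen_s, b) z = (if b then z * (1 + \<xi>) else z / (1 + \<xi>))"
| "affine_act \<xi> (gen_t, b) z = (if b then z * \<xi> else z / \<xi>)"

lemma affine_act_same_element:
  assumes "0 < \<xi>" "same_element \<Gamma>_relators u v"
  shows "fold (affine_act \<xi>) u z = fold (affine_act \<xi>) v z"
  using assms(2)
proof (rule same_element_imp_fold_eq)
  show "affine_act \<xi> (letter_inv x) (affine_act \<xi> x z) = z" for x z
    using \<open>0 < \<xi>\<close> by (cases "(\<xi>, x, z)" rule: affine_act.cases) (auto simp: letter_inv_def)
  show "fold (affine_act \<xi>) r z = z" if "r \<in> \<Gamma>_relators" for r z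
  proof -
    have "\<xi> \<noteq> 0" "1 + \<xi> \<noteq> 0" using \<open>0 < \<xi>\<close> by auto
    then show ?thesis
      using that by (auto simp: \<Gamma>_relators_def gen_word_def word_comm_def word_conj_def relator_def
          Let_def letter_inv_def divide_simps)
  qed
qed

lemma fold_affine_act_s_pow:
  "fold (affine_act \<xi>) (gen_pow gen_s k) z = z * (1 + \<xi>) powi k"
proof -
  have "fold (affine_act \<xi>) (replicate n (gen_s, True)) z = z * (1 + \<xi>) ^ n"
    "fold (affine_act \<xi>) (replicate n (gen_s, False)) z = z * inverse (1 + \<xi>) ^ n" for n
    by (induction n arbitrary: z) (auto simp: field_simps)
  then show ?thesis
    by (auto simp: gen_pow_def power_int_def)
qed

lemma fold_affine_act_t_pow:
  "fold (affine_act \<xi>) (gen_pow gen_t k) z = z * \<xi> powi k"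
proof -
  have "fold (affine_act \<xi>) (replicate n (gen_t, True)) z = z * \<xi> ^ n"
    "fold (affine_act \<xi>) (replicate n (gen_t, False)) z = z * inverse \<xi> ^ n" for n
    by (induction n arbitrary: z) (auto simp: field_simps)
  then show ?thesis
    by (auto simp: gen_pow_def power_int_def)
qed

text \<open>
  The value at \<open>\<xi>\<close> of the Laurent polynomial whose coefficients are the exponent sums of \<open>P\<close>.
\<close>

definition laurent_value :: "int word \<Rightarrow> real \<Rightarrow> real" where
  "laurent_value P \<xi> = (\<Sum>l\<leftarrow>P. (if snd l then 1 else - 1) * \<xi> powi fst l)"

lemma fold_affine_act_a_prod:
  assumes "0 < \<xi>"
  shows "fold (affine_act \<xi>) (a_prod P) z = z + laurent_value P \<xi>"
proof (induction P arbitrary: z)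
  case Nil
  show ?case by (simp add: laurent_value_def)
next
  case (Cons l P)
  have "fold (affine_act \<xi>) (a_conj l) z = z + (if snd l then 1 else - 1) * \<xi> powi fst l"
    using assms by (cases "snd l")
      (simp_all add: a_conj_def word_conj_def fold_affine_act_t_pow power_int_minus field_simps)
  then show ?case
    using Cons by (simp add: laurent_value_def)
qed

lemma exponent_sum_eq_0: "(\<And>l. l \<in> set P \<Longrightarrow> fst l \<noteq> j) \<Longrightarrow> exponent_sum P j = 0"
  by (induction P) auto

text \<open>
  Multiplication by \<open>\<xi>\<^sup>N\<close> clears the negative exponents, so that the finiteness of the set of roots
  of a nonzero polynomial applies.
\<close>

lemma laurent_value_exponent_sum:
  assumes "\<forall>l \<in> set P. \<bar>fst l\<bar> \<le> int N" "0 < \<xi>"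
  shows "\<xi> ^ N * laurent_value P \<xi> = (\<Sum>i\<le>2 * N. of_int (exponent_sum P (int i - int N)) * \<xi> ^ i)"
  using assms(1)
proof (induction P)
  case Nil
  show ?case by (simp add: laurent_value_def)
next
  case (Cons l P)
  let ?e = "if snd l then 1 else - 1 :: int"
  define k where "k = nat (fst l + int N)"
  have k: "k \<le> 2 * N" "fst l = int k - int N"
    using Cons.prems by (auto simp: k_def)
  have "\<xi> ^ N * \<xi> powi fst l = \<xi> ^ k"
    using assms(2) by (simp add: k(2) power_int_diff)
  then have "\<xi> ^ N * laurent_value (l # P) \<xi> = ?e * \<xi> ^ k + \<xi> ^ N * laurent_value P \<xi>"
    by (simp add: laurent_value_def algebra_simps)
  also have "?e * \<xi> ^ k = (\<Sum>i\<le>2 * N. if i = k then ?e * \<xi> ^ k else 0)"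
    using k(1) by simp
  also have "\<dots> = (\<Sum>i\<le>2 * N. of_int (if fst l = int i - int N then ?e else 0) * \<xi> ^ i)"
    by (intro sum.cong) (auto simp: k(2))
  finally show ?case
    using Cons by (simp add: sum.distrib[symmetric] algebra_simps)
qed

lemma laurent_value_zero_imp_exponent_sum_zero:
  assumes "\<And>\<xi>. 0 < \<xi> \<Longrightarrow> laurent_value P \<xi> = 0"
  shows "exponent_sum P j = 0"
proof (rule ccontr)
  assume nz: "exponent_sum P j \<noteq> 0"
  define N where "N = (\<Sum>l\<leftarrow>P. nat \<bar>fst l\<bar>)"
  have N: "\<bar>fst l\<bar> \<le> int N" if "l \<in> set P" for l
    using member_le_sum_list[of "nat \<bar>fst l\<bar>" "map (\<lambda>l. nat \<bar>fst l\<bar>) P"] that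
    by (auto simp: N_def)
  define c where "c i = real_of_int (exponent_sum P (int i - int N))" for i
  have "\<exists>l \<in> set P. fst l = j"
    using nz exponent_sum_eq_0 by blast
  with N have "\<bar>j\<bar> \<le> int N"
    by auto
  then have "\<exists>i\<le>2 * N. c i \<noteq> 0"
    using nz by (intro exI[of _ "nat (j + int N)"]) (auto simp: c_def)
  then have "finite {\<xi>. (\<Sum>i\<le>2 * N. c i * \<xi> ^ i) = 0}"
    using polyfun_finite_roots by blast
  moreover have "{0<..} \<subseteq> {\<xi>. (\<Sum>i\<le>2 * N. c i * \<xi> ^ i) = 0}"
    using laurent_value_exponent_sum[of P N] N assms by (auto simp: c_def)
  ultimately show False
    using infinite_Ioi[of "0::real"] finite_subset by blast
qed

section \<open>The upper bound\<close>

lemma area_upper_bound: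
  assumes "represents_identity \<Gamma>_relators w" and "length w \<le> n"
  shows "word_area \<Gamma>_relators w \<le> 30 * 2 ^ (30 * n + 30)"
proof -
  let ?s = "gen_pow gen_s" and ?t = "gen_pow gen_t"
  define k where "k = length w"
  define K where "K = k * (k + 4 ^ (2 * k) * (2 * (k + 2 * k) + 1))"
  obtain P m' q' where
    P: "?s (- int k) @ ?t 0 @ w \<approx>\<langle>K\<rangle> a_prod P @ ?s (- int m') @ ?t q'"
    and length_P: "length P \<le> k * 2 ^ (2 * k)"
    and bound_P: "\<forall>l \<in> set P. \<bar>fst l\<bar> \<le> int (3 * k)"
    using collect_word[of w k "2 * k" 0 k] by (auto simp: k_def K_def)
  have action: "z * (1 + \<xi>) powi (- int k) = (z + laurent_value P \<xi>) * (1 + \<xi>) powi (- int m') * \<xi> powi q'"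
    if "0 < \<xi>" for \<xi> z :: real
  proof -
    have "same_element \<Gamma>_relators (?s (- int k)) (?s (- int k) @ ?t 0 @ w)"
      using same_element_append[OF same_element.refl[of _ "?s (- int k)"] assms(1)]
      by (simp add: same_element.sym)
    also have "same_element \<Gamma>_relators \<dots> (a_prod P @ ?s (- int m') @ ?t q')"
      using P by (rule equal_within_imp_same_element)
    finally have "fold (affine_act \<xi>) (?s (- int k)) z
        = fold (affine_act \<xi>) (a_prod P @ ?s (- int m') @ ?t q') z"
      by (rule affine_act_same_element[OF that])
    then show ?thesis
      by (simp add: fold_affine_act_s_pow fold_affine_act_t_pow fold_affine_act_a_prod that)
  qed
  (* At z = 0 the action shows that the translation part vanishes, at z = 1 it then compares the
     slopes; the values 1 and 2 of xi separate the exponents of s and t in the slope. *)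
  have "laurent_value P \<xi> = 0" if "0 < \<xi>" for \<xi>
    using action[OF that, of 0] that by simp
  then have exps: "exponent_sum P j = 0" for j
    by (rule laurent_value_zero_imp_exponent_sum_zero)
  have slope: "(1 + \<xi>) powi (- int k) = (1 + \<xi>) powi (- int m') * \<xi> powi q'" if "0 < \<xi>" for \<xi> :: real
    using action[OF that, of 1] action[OF that, of 0] that by simp
  have m': "m' = k"
    using slope[of 1] by (simp add: power_int_minus)
  have "2 powi q' = (1::real)"
    using slope[of 2] by (simp add: m')
  then have q': "q' = 0"
    using power_int_strict_increasing[of q' 0 "2::real"] power_int_strict_increasing[of 0 q' "2::real"]
    by (metis linorder_neq_iff order.irrefl power_int_0_right one_less_numeral_iff semiring_norm(76))
  have "intertwines \<Gamma>_relators (16 ^ (6 * k)) (a_conj l) (a_conj m) (a_conj m)"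
    if "l \<in> set P" "m \<in> set P" for l m
    using bound_P[rule_format, OF that(1)] bound_P[rule_format, OF that(2)]
    by (intro a_conj_commute) auto
  from a_prod_exponent_sum_zero[OF this exps]
  have "a_prod P \<approx>\<langle>16 ^ (6 * k) * (length P)\<^sup>2\<rangle> []" by blast
  from equal_within.trans[OF P[unfolded m' q'] equal_within_right[OF this]]
  have "?s (- int k) @ w \<approx>\<langle>K + 16 ^ (6 * k) * (length P)\<^sup>2\<rangle> ?s (- int k) @ []"
    by simp
  then have "word_area \<Gamma>_relators w \<le> K + 16 ^ (6 * k) * (length P)\<^sup>2"
    by (rule word_area_le[OF equal_within_cancel_left])
  also have "\<dots> \<le> 30 * 2 ^ (30 * n + 30)"
  proof -
    (* Everything is a polynomial in X = 2^k of degree at most 30; the dominant term is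
       X^24 * (X * X^2)^2, the exchanges in P. *)
    define X :: nat where "X = 2 ^ k"
    have X: "k \<le> X" "1 \<le> X" by (auto simp: X_def less_imp_le)
    have "(4::nat) ^ (2 * k) = (2 ^ 2) ^ (2 * k)" "(16::nat) ^ (6 * k) = (2 ^ 4) ^ (6 * k)"
      by simp_all
    then have p4: "(4::nat) ^ (2 * k) = X ^ 4" "(2::nat) ^ (2 * k) = X ^ 2" "(16::nat) ^ (6 * k) = X ^ 24"
      unfolding X_def power_mult[symmetric] by (simp_all add: mult.commute)
    have "K \<le> X * (X + X ^ 4 * (2 * (X + 2 * X) + X))"
      unfolding K_def p4 using X by (intro mult_le_mono add_le_mono) auto
    also have "\<dots> = X ^ 2 + 7 * X ^ 6"
      by (simp add: algebra_simps power_numeral_reduce)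
    also have "\<dots> \<le> X ^ 30 + 7 * X ^ 30"
      using X by (intro add_le_mono mult_le_mono power_increasing) auto
    finally have K: "K \<le> 8 * X ^ 30" by simp
    have "length P \<le> X * X ^ 2"
      using length_P mult_le_mono1[OF X(1), of "X ^ 2"] unfolding p4 by linarith
    then have "16 ^ (6 * k) * (length P)\<^sup>2 \<le> X ^ 24 * (X * X ^ 2)\<^sup>2"
      unfolding p4 by (intro mult_le_mono power_mono) auto
    also have "(X * X ^ 2)\<^sup>2 = X ^ 6"
      by (simp add: power_numeral_reduce)
    also have "X ^ 24 * X ^ 6 = X ^ 30"
      by (simp flip: power_add)
    finally have "K + 16 ^ (6 * k) * (length P)\<^sup>2 \<le> 9 * X ^ 30"
      using K by simp
    also have "X ^ 30 = 2 ^ (30 * k)"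
      unfolding X_def power_mult[symmetric] by (simp add: mult.commute)
    also have "9 * (2::nat) ^ (30 * k) \<le> 30 * 2 ^ (30 * n + 30)"
      using assms(2) by (intro mult_le_mono power_increasing) (auto simp: k_def)
    finally show ?thesis .
  qed
  finally show ?thesis .
qed

section \<open>The lower bound\<close>

text \<open>
  The Heisenberg group is \<open>\<int>\<^sup>2 \<times> \<int>\<close> with product
  \<open>(v, c) (v', c') = (v + v', c + c' + 3 det(v, v'))\<close>.  The letter \<open>a\<close> acts by right multiplication by
  \<open>((1, 0), -1)\<close>; \<open>t\<close> and \<open>s\<close> act by the automorphisms \<open>(v, c) \<mapsto> (T v, c)\<close> and
  \<open>(v, c) \<mapsto> ((1 + T) v, -c)\<close>, where \<open>T (p, q) = (-q, p - 3 q)\<close>.  The last coordinate \<open>\<alpha>\<close> of \<open>a\<close> and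
  the factor \<open>\<beta>\<close> in front of the determinant are related by \<open>a\<^sup>s = a a\<^sup>t\<close>, which says that
  \<open>- \<alpha> = 2 \<alpha> + \<beta> det((1, 0), (0, 1))\<close>; the choice \<open>\<alpha> = -1\<close>, \<open>\<beta> = 3\<close> solves this in integers.  Then
  \<open>[a, a\<^sup>t]\<close> acts by adding \<open>6\<close> to the central coordinate.
\<close>

fun heis_act :: "gen \<times> bool \<Rightarrow> int \<times> int \<times> int \<Rightarrow> int \<times> int \<times> int" where
  "heis_act (gen_a, b) (p, q, c) = (if b then (p + 1, q, c - 1 - 3 * q) else (p - 1, q, c + 1 + 3 * q))"
| "heis_act (gen_s, b) (p, q, c) = (if b then (p - q, p - 2 * q, - c) else (2 * p - q, p - q, - c))"
| "heis_act (gen_t, b) (p, q, c) = (if b then (- q, p - 3 * q, c) else (q - 3 * p, - p, c))"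

definition central_shift :: "gen word \<Rightarrow> int \<Rightarrow> bool" where
  "central_shift w d \<longleftrightarrow> (\<forall>p q c. fold heis_act w (p, q, c) = (p, q, c + d))"

lemma heis_act_letter_inv: "heis_act (letter_inv x) (heis_act x z) = z"
proof -
  show ?thesis
    by (cases "(x, z)" rule: heis_act.cases) (auto simp: letter_inv_def)
qed

lemma central_shift_relator:
  assumes "r \<in> \<Gamma>_relators \<union> word_inv ` \<Gamma>_relators"
  shows "\<exists>d. \<bar>d\<bar> \<le> 6 \<and> central_shift r d"
proof -
  have *: "central_shift r 6 \<or> central_shift r 0" if "r \<in> \<Gamma>_relators" for r
    using that by (auto simp: central_shift_def \<Gamma>_relators_def gen_word_def word_comm_def
        word_conj_def relator_def Let_def letter_inv_def)
  have **: "central_shift r (- 6) \<or> central_shift r 0" if "r \<in> word_inv ` \<Gamma>_relators" for r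
    using that by (auto simp: central_shift_def \<Gamma>_relators_def gen_word_def word_comm_def
        word_conj_def relator_def Let_def letter_inv_def)
  from assms show ?thesis
  proof
    assume "r \<in> \<Gamma>_relators"
    from *[OF this] show ?thesis by (auto intro: exI[of _ 6] exI[of _ 0])
  next
    assume "r \<in> word_inv ` \<Gamma>_relators"
    from **[OF this] show ?thesis by (auto intro: exI[of _ "- 6"] exI[of _ 0])
  qed
qed

text \<open>
  The letters \<open>a\<close> and \<open>t\<close> commute with central shifts, and \<open>s\<close> reverses their sign because \<open>1 + T\<close>
  has determinant \<open>-1\<close>.
\<close>

lemma central_shift_word_conj:
  "central_shift r d \<Longrightarrow> \<exists>e. \<bar>e\<bar> = \<bar>d\<bar> \<and> central_shift (word_conj r u) e"
proof (induction u arbitrary: r d)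
  case Nil
  then show ?case by (auto simp: word_conj_def)
next
  case (Cons x u)
  obtain y b where x: "x = (y, b)" by fastforce
  have "\<exists>e. \<bar>e\<bar> = \<bar>d\<bar> \<and> central_shift (word_conj r [x]) e"
  proof (cases y)
    case gen_s
    then show ?thesis using Cons.prems
      by (intro exI[of _ "- d"]) (auto simp: x central_shift_def word_conj_def letter_inv_def)
  qed (use Cons.prems in \<open>auto simp: x central_shift_def word_conj_def letter_inv_def intro!: exI[of _ d]\<close>)
  then obtain e where "\<bar>e\<bar> = \<bar>d\<bar>" "central_shift (word_conj r [x]) e" by blast
  with Cons.IH[of "word_conj r [x]" e] show ?case
    by (auto simp: word_conj_def)
qed

lemma central_shift_conj_product:
  assumes "\<forall>(u, r) \<in> set ps. r \<in> \<Gamma>_relators \<union> word_inv ` \<Gamma>_relators"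
  shows "\<exists>d. \<bar>d\<bar> \<le> 6 * int (length ps) \<and> central_shift (conj_product ps) d"
  using assms
proof (induction ps)
  case Nil
  show ?case by (auto simp: central_shift_def)
next
  case (Cons x ps)
  obtain u r where x: "x = (u, r)" by fastforce
  obtain d where d: "\<bar>d\<bar> \<le> 6 * int (length ps)" "central_shift (conj_product ps) d"
    using Cons by auto
  obtain f where "\<bar>f\<bar> \<le> 6" "central_shift r f"
    using central_shift_relator[of r] Cons.prems x by auto
  then obtain e where "\<bar>e\<bar> \<le> 6" "central_shift (word_conj r u) e"
    using central_shift_word_conj[of r f u] by metis
  with d show ?case
    by (intro exI[of _ "e + d"]) (auto simp: central_shift_def x)
qed

text \<open>
  The action respects free equality but not the relator \<open>[a, a\<^sup>t]\<close>, so the central shift by which a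
  word acts counts, with signs, the conjugates of that relator in any product equal to the word.
\<close>

lemma area_ge_central_shift:
  assumes "represents_identity \<Gamma>_relators w" and "central_shift w d"
  shows "\<bar>d\<bar> \<le> 6 * int (word_area \<Gamma>_relators w)"
proof -
  have "is_product_of_conjugates \<Gamma>_relators w (word_area \<Gamma>_relators w)"
    using LeastI_ex[OF assms(1)[unfolded represents_identity_iff_product_of_conjugates]]
    unfolding word_area_def .
  then obtain ps where ps: "length ps = word_area \<Gamma>_relators w"
    "\<forall>(u, r) \<in> set ps. r \<in> \<Gamma>_relators \<union> word_inv ` \<Gamma>_relators"
    and eq: "freely_equal w (conj_product ps)"
    unfolding is_product_of_conjugates_def by blast
  obtain e where e: "\<bar>e\<bar> \<le> 6 * int (length ps)" "central_shift (conj_product ps) e"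
    using central_shift_conj_product[OF ps(2)] by blast
  have "fold heis_act w (0, 0, 0) = fold heis_act (conj_product ps) (0, 0, 0)"
    by (rule same_element_imp_fold_eq[OF eq]) (simp_all add: heis_act_letter_inv)
  then have "d = e"
    using assms(2) e(2) by (auto simp: central_shift_def)
  then show ?thesis
    using e(1) ps(1) by simp
qed

text \<open>
  Here \<open>(x, y)\<close> is \<open>T\<^sup>n\<^sup>+\<^sup>1 (1, 0)\<close>.  Applying \<open>T\<close> yields \<open>(-y, x - 3 y)\<close>, and if \<open>\<bar>x\<bar> \<le> \<bar>y\<bar>\<close> then
  \<open>\<bar>x - 3 y\<bar> \<ge> 2 \<bar>y\<bar>\<close>, so both inequalities persist.
\<close>

lemma heis_act_a_conj:
  "\<exists>x y. \<bar>x\<bar> \<le> \<bar>y\<bar> \<and> 2 ^ n \<le> \<bar>y\<bar> \<and>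
    (\<forall>p q c. fold heis_act (a_conj (int n + 1, True)) (p, q, c)
        = (p + x, q + y, c - 1 + 3 * (p * y - q * x)) \<and>
      fold heis_act (a_conj (int n + 1, False)) (p, q, c)
        = (p - x, q - y, c + 1 - 3 * (p * y - q * x)))"
proof (induction n)
  case 0
  show ?case
    by (rule exI[of _ 0], rule exI[of _ 1])
      (auto simp: a_conj_def word_conj_def gen_pow_def letter_inv_def)
next
  case (Suc n)
  then obtain x y where xy: "\<bar>x\<bar> \<le> \<bar>y\<bar>" "2 ^ n \<le> \<bar>y\<bar>"
    and act: "fold heis_act (a_conj (int n + 1, True)) (p, q, c)
        = (p + x, q + y, c - 1 + 3 * (p * y - q * x))"
      "fold heis_act (a_conj (int n + 1, False)) (p, q, c)
        = (p - x, q - y, c + 1 - 3 * (p * y - q * x))" for p q c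
    by blast
  have pow: "gen_pow gen_t (int (Suc n) + 1) = gen_pow gen_t (int n + 1) @ [(gen_t, True)]"
    by (simp add: gen_pow_def nat_add_distrib replicate_append_same)
  have step: "a_conj (int (Suc n) + 1, b) = [(gen_t, False)] @ a_conj (int n + 1, b) @ [(gen_t, True)]" for b
    unfolding a_conj_def word_conj_def fst_conv snd_conv pow by (simp add: letter_inv_def)
  show ?case
    unfolding step
  proof (rule exI[of _ "- y"], rule exI[of _ "x - 3 * y"], intro conjI allI, goal_cases)
    case 1
    show ?case using xy by linarith
  next
    case 2
    show ?case using xy unfolding power_Suc by linarith
  next
    case (3 p q c)
    show ?case by (simp add: act) (simp add: algebra_simps)
  next
    case (4 p q c)
    show ?case by (simp add: act) (simp add: algebra_simps)
  qed
qed

text \<open>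
  The witness is \<open>[a, a\<^sub>n\<^sub>+\<^sub>1]\<close>, which acts by a central shift of \<open>6 det((1, 0), T\<^sup>n\<^sup>+\<^sup>1 (1, 0))\<close>.
\<close>

lemma area_lower_bound:
  "\<exists>w. length w \<le> 8 * n + 8 \<and> represents_identity \<Gamma>_relators w \<and> 2 ^ n \<le> word_area \<Gamma>_relators w"
proof -
  define w where "w = word_comm (a_conj (0, True)) (a_conj (int n + 1, True))"
  have null: "represents_identity \<Gamma>_relators w"
  proof -
    have "intertwines \<Gamma>_relators (16 ^ (n + 1)) (word_inv (a_conj (0, True)))
        (word_inv (a_conj (int n + 1, True))) (word_inv (a_conj (int n + 1, True)))"
      unfolding a_conj_letter_inv[symmetric] by (rule a_conj_commute) (simp add: letter_inv_def)
    from equal_within_right[OF this[unfolded intertwines_def], of "a_conj (0, True) @ a_conj (int n + 1, True)"]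
    have "same_element \<Gamma>_relators w (word_inv (a_conj (int n + 1, True)) @ word_inv (a_conj (0, True)) @
        a_conj (0, True) @ a_conj (int n + 1, True))"
      unfolding w_def word_comm_def by (intro equal_within_imp_same_element) simp
    also have "same_element \<Gamma>_relators \<dots> []"
      using same_element_left_inv[of \<Gamma>_relators "a_conj (0, True) @ a_conj (int n + 1, True)"] by simp
    finally show ?thesis .
  qed
  obtain x y where y: "2 ^ n \<le> \<bar>y\<bar>" and
    act: "fold heis_act (a_conj (int n + 1, True)) (p, q, c)
        = (p + x, q + y, c - 1 + 3 * (p * y - q * x))"
      "fold heis_act (a_conj (int n + 1, False)) (p, q, c)
        = (p - x, q - y, c + 1 - 3 * (p * y - q * x))" for p q c
    using heis_act_a_conj by blast
  have "central_shift w (6 * y)"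
  proof -
    have "w = [(gen_a, False)] @ a_conj (int n + 1, False) @ [(gen_a, True)] @ a_conj (int n + 1, True)"
      unfolding w_def word_comm_def a_conj_letter_inv[symmetric]
      by (simp add: letter_inv_def a_conj_def word_conj_def)
    then show ?thesis
      unfolding central_shift_def by (simp add: act) (simp add: algebra_simps)
  qed
  from area_ge_central_shift[OF null this] y have "2 ^ n \<le> int (word_area \<Gamma>_relators w)"
    unfolding abs_mult by linarith
  then have "2 ^ n \<le> word_area \<Gamma>_relators w"
    by (metis of_nat_le_iff of_nat_numeral of_nat_power)
  moreover have "length w \<le> 8 * n + 8"
    by (simp add: w_def word_comm_def a_conj_def word_conj_def)
  ultimately show ?thesis
    using null by blast
qed

theorem theorem1p1:
  shows "dehn_function \<Gamma>_relators \<simeq> (\<lambda>n. 2 ^ n)"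
  unfolding growth_equiv_def growth_le_def
proof (intro conjI exI allI)
  fix n :: nat
  let ?W = "\<lambda>n. {w. length w \<le> n \<and> represents_identity \<Gamma>_relators w}"
  have fin: "finite (word_area \<Gamma>_relators ` ?W n)" for n
    using finite_words_representing_identity by blast
  have "dehn_function \<Gamma>_relators n \<le> 30 * 2 ^ (30 * n + 30)"
    unfolding dehn_function_def using fin empty_word_representing_identity[of n \<Gamma>_relators]
    by (intro Max.boundedI) (blast intro: area_upper_bound)+
  then show "dehn_function \<Gamma>_relators n \<le> 30 * 2 ^ (30 * n + 30) + 30 * n + 30"
    by simp
  obtain w where "w \<in> ?W (8 * n + 8)" "2 ^ n \<le> word_area \<Gamma>_relators w"
    using area_lower_bound[of n] by blast
  moreover from this have "word_area \<Gamma>_relators w \<le> dehn_function \<Gamma>_relators (8 * n + 8)"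
    unfolding dehn_function_def using fin by (intro Max_ge) auto
  ultimately show "2 ^ n \<le> 8 * dehn_function \<Gamma>_relators (8 * n + 8) + 8 * n + 8"
    by linarith
qed simp_all

end
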